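(* Whenever $\mathcal{G}\ast\Gamma\Rightarrow\Delta, A$ and $\mathcal{H}\ast A,\Sigma\Rightarrow\Pi$ are both derivable in $\mathsf{LNS}_\mathsf{Kt}$ (with $\mathcal{G}\ast\Gamma\Rightarrow\Delta$ and $\mathcal{H}\ast A,\Sigma\Rightarrow\Pi$ structurally equivalent), then $(\mathcal{G}\oplus\mathcal{H})\ast\Gamma,\Sigma\Rightarrow\Delta,\Pi$ is also derivable in $\mathsf{LNS}_\mathsf{Kt}$.
   Context: Formulae of tense logic $\mathsf{Kt}$ are built from atoms $p$ by $A := p \mid \bot \mid A \to A \mid \Box A \mid \Diamond A \mid \blacksquare A \mid \Diamond^{-1} A$, where $\Diamond^{-1}$ denotes the backwards (past) diamond, dual of $\blacksquare$. A linear nested sequent is given by $S := \Gamma\Rightarrow\Delta \mid \Gamma\Rightarrow\Delta \nearrow S \mid \Gamma\Rightarrow\Delta \swarrow S$ with $\Gamma,\Delta$ finite multisets of formulae ($\epsilon$ for empty); $\mathcal{G},\mathcal{H}$ denote possibly empty contexts and $\ast$ stands for either $\nearrow$ or $\swarrow$. The merge $\oplus$ of two linear nested sequents is defined (for nonempty $\mathcal{G},\mathcal{H}$) by $(\Gamma\Rightarrow\Delta)\oplus(\Sigma\Rightarrow\Pi)=\Gamma,\Sigma\Rightarrow\Delta,\Pi$; $(\Gamma\Rightarrow\Delta)\oplus(\Sigma\Rightarrow\Pi\ast\mathcal{H})=\Gamma,\Sigma\Rightarrow\Delta,\Pi\ast\mathcal{H}$; $(\Gamma\Rightarrow\Delta\ast\mathcal{H})\oplus(\Sigma\Rightarrow\Pi)=\Gamma,\Sigma\Rightarrow\Delta,\Pi\ast\mathcal{H}$;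 $(\Gamma\Rightarrow\Delta\nearrow\mathcal{G})\oplus(\Sigma\Rightarrow\Pi\nearrow\mathcal{H})=\Gamma,\Sigma\Rightarrow\Delta,\Pi\nearrow(\mathcal{G}\oplus\mathcal{H})$; $(\Gamma\Rightarrow\Delta\swarrow\mathcal{G})\oplus(\Sigma\Rightarrow\Pi\swarrow\mathcal{H})=\Gamma,\Sigma\Rightarrow\Delta,\Pi\swarrow(\mathcal{G}\oplus\mathcal{H})$; so the merge is only defined for structurally equivalent sequents (same pattern of nesting operators). The calculus $\mathsf{LNS}_\mathsf{Kt}$ has the following rules (premisses before "/", conclusion after): $\Box_R^1$: $\mathcal{G}\ast\Gamma\Rightarrow\Delta,A\swarrow\Sigma\Rightarrow\Pi,\Box A$ and $\mathcal{G}\ast\Gamma\Rightarrow\Delta\swarrow\Sigma\Rightarrow\Pi,\Box A\nearrow\epsilon\Rightarrow A$ / $\mathcal{G}\ast\Gamma\Rightarrow\Delta\swarrow\Sigma\Rightarrow\Pi,\Box A$; $\blacksquare_R^1$: $\mathcal{G}\ast\Gamma\Rightarrow\Delta,A\nearrow\Sigma\Rightarrow\Pi,\blacksquare A$ and $\mathcal{G}\ast\Gamma\Rightarrow\Delta\nearrow\Sigma\Rightarrow\Pi,\blacksquare A\swarrow\epsilon\Rightarrow A$ / $\mathcal{G}\ast\Gamma\Rightarrow\Delta\nearrow\Sigma\Rightarrow\Pi,\blacksquare A$; $\Box_R^2$: $\mathcal{G}\nearrow\Gamma\Rightarrow\Delta,\Box A\nearrow\epsilon\Rightarrow A$ / $\mathcal{G}\nearrow\Gamma\Rightarrow\Delta,\Box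 A$; $\blacksquare_R^2$: $\mathcal{G}\swarrow\Gamma\Rightarrow\Delta,\blacksquare A\swarrow\epsilon\Rightarrow A$ / $\mathcal{G}\swarrow\Gamma\Rightarrow\Delta,\blacksquare A$; $\Box_L^1$: $\mathcal{G}\ast\Gamma,\Box A\Rightarrow\Delta\nearrow\Sigma,A\Rightarrow\Pi$ / $\mathcal{G}\ast\Gamma,\Box A\Rightarrow\Delta\nearrow\Sigma\Rightarrow\Pi$; $\blacksquare_L^1$: $\mathcal{G}\ast\Gamma,\blacksquare A\Rightarrow\Delta\swarrow\Sigma,A\Rightarrow\Pi$ / $\mathcal{G}\ast\Gamma,\blacksquare A\Rightarrow\Delta\swarrow\Sigma\Rightarrow\Pi$; $\Box_L^2$: $\mathcal{G}\ast\Gamma,A\Rightarrow\Delta$ / $\mathcal{G}\ast\Gamma\Rightarrow\Delta\swarrow\Sigma,\Box A\Rightarrow\Pi$; $\blacksquare_L^2$: $\mathcal{G}\ast\Gamma,A\Rightarrow\Delta$ / $\mathcal{G}\ast\Gamma\Rightarrow\Delta\nearrow\Sigma,\blacksquare A\Rightarrow\Pi$; (id): $\mathcal{G}\ast\Gamma,p\Rightarrow p,\Delta$; $\bot_L$: $\mathcal{G}\ast\Gamma,\bot\Rightarrow\Delta$; $\mathsf{EW}$: $\mathcal{G}$ / $\mathcal{G}\ast\Gamma\Rightarrow\Delta$; $\to_R$: $\mathcal{G}\ast\Gamma,A\Rightarrow\Delta,A\to B,B$ / $\mathcal{G}\ast\Gamma\Rightarrow\Delta,A\to B$; $\to_L$: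 $\mathcal{G}\ast\Gamma,A\to B,B\Rightarrow\Delta$ and $\mathcal{G}\ast\Gamma,A\to B\Rightarrow\Delta,A$ / $\mathcal{G}\ast\Gamma,A\to B\Rightarrow\Delta$. *)

theory Defs
  imports "HOL-Library.Multiset"
begin

text \<open>
  The white modalities look forward, the black ones backward. All four are primitive
  constructors, as in the grammar; the calculus below has no logical rules for the two diamonds.
\<close>

datatype 'p fm =
    Atom 'p
  | Bot
  | Imp "'p fm" "'p fm"
  | Box "'p fm"
  | Dia "'p fm"
  | BBox "'p fm"
  | BDia "'p fm"

datatype 'p sequent = Sequent "'p fm multiset" "'p fm multiset"  (infix "\<Rightarrow>\<^sub>s" 45)

text \<open>\<open>Fwd\<close> is the nesting operator written as a north-east arrow, \<open>Bwd\<close> the south-west arrow.\<close>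

datatype nesting = Fwd | Bwd

datatype 'p lns =
    Last "'p sequent"
  | Nest "'p sequent" nesting "'p lns"

fun append_lns :: "'p lns \<Rightarrow> nesting \<Rightarrow> 'p lns \<Rightarrow> 'p lns" where
  "append_lns (Last s) d S = Nest s d S"
| "append_lns (Nest s e G) d S = Nest s e (append_lns G d S)"

text \<open>
  A possibly empty context is an optional linear nested sequent. \<open>plug G d S\<close> is the linear
  nested sequent consisting of \<open>G\<close>, the nesting operator \<open>d\<close> and \<open>S\<close>; for empty \<open>G\<close> the operator
  disappears and only \<open>S\<close> is left.
\<close>

fun plug :: "'p lns option \<Rightarrow> nesting \<Rightarrow> 'p lns \<Rightarrow> 'p lns" where
  "plug None d S = S"
| "plug (Some G) d S = append_lns G d S"

fun ops :: "'p lns \<Rightarrow> nesting list" where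
  "ops (Last s) = []"
| "ops (Nest s d S) = d # ops S"

definition struct_equiv :: "'p lns \<Rightarrow> 'p lns \<Rightarrow> bool" where
  "struct_equiv S T \<longleftrightarrow> ops S = ops T"

text \<open>
  The merge is a partial operation: there is deliberately no equation for clashing nesting
  operators, where the result is \<open>undefined\<close>. It is total on structurally equivalent arguments.
\<close>

fun merge_lns :: "'p lns \<Rightarrow> 'p lns \<Rightarrow> 'p lns"  (infixr "\<oplus>" 65) where
  "Last (\<Gamma> \<Rightarrow>\<^sub>s \<Delta>) \<oplus> Last (\<Sigma> \<Rightarrow>\<^sub>s \<Pi>) = Last (\<Gamma> + \<Sigma> \<Rightarrow>\<^sub>s \<Delta> + \<Pi>)"
| "Last (\<Gamma> \<Rightarrow>\<^sub>s \<Delta>) \<oplus> Nest (\<Sigma> \<Rightarrow>\<^sub>s \<Pi>) d H = Nest (\<Gamma> + \<Sigma> \<Rightarrow>\<^sub>s \<Delta> + \<Pi>) d H"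
| "Nest (\<Gamma> \<Rightarrow>\<^sub>s \<Delta>) d H \<oplus> Last (\<Sigma> \<Rightarrow>\<^sub>s \<Pi>) = Nest (\<Gamma> + \<Sigma> \<Rightarrow>\<^sub>s \<Delta> + \<Pi>) d H"
| "Nest (\<Gamma> \<Rightarrow>\<^sub>s \<Delta>) Fwd G \<oplus> Nest (\<Sigma> \<Rightarrow>\<^sub>s \<Pi>) Fwd H = Nest (\<Gamma> + \<Sigma> \<Rightarrow>\<^sub>s \<Delta> + \<Pi>) Fwd (G \<oplus> H)"
| "Nest (\<Gamma> \<Rightarrow>\<^sub>s \<Delta>) Bwd G \<oplus> Nest (\<Sigma> \<Rightarrow>\<^sub>s \<Pi>) Bwd H = Nest (\<Gamma> + \<Sigma> \<Rightarrow>\<^sub>s \<Delta> + \<Pi>) Bwd (G \<oplus> H)"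

text \<open>
  Merge of possibly empty contexts. The mixed cases, which never arise from structurally
  equivalent sequents, are left unspecified.
\<close>

fun merge_ctx :: "'p lns option \<Rightarrow> 'p lns option \<Rightarrow> 'p lns option" where
  "merge_ctx None None = None"
| "merge_ctx (Some G) (Some H) = Some (G \<oplus> H)"

text \<open>
  The operator argument \<open>d\<close> of \<open>plug\<close> is arbitrary where the rules allow either nesting operator.
  In \<open>BoxR2\<close> and \<open>BBoxR2\<close> it is fixed, but as the context may be empty both rules also apply to
  linear nested sequents with a single component. The rule \<open>EW\<close> removes a proper last component,
  so its context is nonempty.
\<close>

inductive derivable :: "'p lns \<Rightarrow> bool" where
  BoxR1:
  "derivable (plug G d (Nest (\<Gamma> \<Rightarrow>\<^sub>s add_mset A \<Delta>) Bwd (Last (\<Sigma> \<Rightarrow>\<^sub>s add_mset (Box A) \<Pi>)))) \<Longrightarrow>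
   derivable (plug G d (Nest (\<Gamma> \<Rightarrow>\<^sub>s \<Delta>) Bwd
      (Nest (\<Sigma> \<Rightarrow>\<^sub>s add_mset (Box A) \<Pi>) Fwd (Last ({#} \<Rightarrow>\<^sub>s {#A#}))))) \<Longrightarrow>
   derivable (plug G d (Nest (\<Gamma> \<Rightarrow>\<^sub>s \<Delta>) Bwd (Last (\<Sigma> \<Rightarrow>\<^sub>s add_mset (Box A) \<Pi>))))"
| BBoxR1:
  "derivable (plug G d (Nest (\<Gamma> \<Rightarrow>\<^sub>s add_mset A \<Delta>) Fwd (Last (\<Sigma> \<Rightarrow>\<^sub>s add_mset (BBox A) \<Pi>)))) \<Longrightarrow>
   derivable (plug G d (Nest (\<Gamma> \<Rightarrow>\<^sub>s \<Delta>) Fwd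
      (Nest (\<Sigma> \<Rightarrow>\<^sub>s add_mset (BBox A) \<Pi>) Bwd (Last ({#} \<Rightarrow>\<^sub>s {#A#}))))) \<Longrightarrow>
   derivable (plug G d (Nest (\<Gamma> \<Rightarrow>\<^sub>s \<Delta>) Fwd (Last (\<Sigma> \<Rightarrow>\<^sub>s add_mset (BBox A) \<Pi>))))"
| BoxR2:
  "derivable (plug G Fwd (Nest (\<Gamma> \<Rightarrow>\<^sub>s add_mset (Box A) \<Delta>) Fwd (Last ({#} \<Rightarrow>\<^sub>s {#A#})))) \<Longrightarrow>
   derivable (plug G Fwd (Last (\<Gamma> \<Rightarrow>\<^sub>s add_mset (Box A) \<Delta>)))"
| BBoxR2:
  "derivable (plug G Bwd (Nest (\<Gamma> \<Rightarrow>\<^sub>s add_mset (BBox A) \<Delta>) Bwd (Last ({#} \<Rightarrow>\<^sub>s {#A#})))) \<Longrightarrow>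
   derivable (plug G Bwd (Last (\<Gamma> \<Rightarrow>\<^sub>s add_mset (BBox A) \<Delta>)))"
| BoxL1:
  "derivable (plug G d (Nest (add_mset (Box A) \<Gamma> \<Rightarrow>\<^sub>s \<Delta>) Fwd (Last (add_mset A \<Sigma> \<Rightarrow>\<^sub>s \<Pi>)))) \<Longrightarrow>
   derivable (plug G d (Nest (add_mset (Box A) \<Gamma> \<Rightarrow>\<^sub>s \<Delta>) Fwd (Last (\<Sigma> \<Rightarrow>\<^sub>s \<Pi>))))"
| BBoxL1:
  "derivable (plug G d (Nest (add_mset (BBox A) \<Gamma> \<Rightarrow>\<^sub>s \<Delta>) Bwd (Last (add_mset A \<Sigma> \<Rightarrow>\<^sub>s \<Pi>)))) \<Longrightarrow>
   derivable (plug G d (Nest (add_mset (BBox A) \<Gamma> \<Rightarrow>\<^sub>s \<Delta>) Bwd (Last (\<Sigma> \<Rightarrow>\<^sub>s \<Pi>))))"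
| BoxL2:
  "derivable (plug G d (Last (add_mset A \<Gamma> \<Rightarrow>\<^sub>s \<Delta>))) \<Longrightarrow>
   derivable (plug G d (Nest (\<Gamma> \<Rightarrow>\<^sub>s \<Delta>) Bwd (Last (add_mset (Box A) \<Sigma> \<Rightarrow>\<^sub>s \<Pi>))))"
| BBoxL2:
  "derivable (plug G d (Last (add_mset A \<Gamma> \<Rightarrow>\<^sub>s \<Delta>))) \<Longrightarrow>
   derivable (plug G d (Nest (\<Gamma> \<Rightarrow>\<^sub>s \<Delta>) Fwd (Last (add_mset (BBox A) \<Sigma> \<Rightarrow>\<^sub>s \<Pi>))))"
| Id:
  "derivable (plug G d (Last (add_mset (Atom p) \<Gamma> \<Rightarrow>\<^sub>s add_mset (Atom p) \<Delta>)))"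
| BotL:
  "derivable (plug G d (Last (add_mset Bot \<Gamma> \<Rightarrow>\<^sub>s \<Delta>)))"
| EW:
  "derivable G \<Longrightarrow> derivable (plug (Some G) d (Last (\<Gamma> \<Rightarrow>\<^sub>s \<Delta>)))"
| ImpR:
  "derivable (plug G d (Last (add_mset A \<Gamma> \<Rightarrow>\<^sub>s add_mset (Imp A B) (add_mset B \<Delta>)))) \<Longrightarrow>
   derivable (plug G d (Last (\<Gamma> \<Rightarrow>\<^sub>s add_mset (Imp A B) \<Delta>)))"
| ImpL:
  "derivable (plug G d (Last (add_mset (Imp A B) (add_mset B \<Gamma>) \<Rightarrow>\<^sub>s \<Delta>))) \<Longrightarrow>
   derivable (plug G d (Last (add_mset (Imp A B) \<Gamma> \<Rightarrow>\<^sub>s add_mset A \<Delta>))) \<Longrightarrow>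
   derivable (plug G d (Last (add_mset (Imp A B) \<Gamma> \<Rightarrow>\<^sub>s \<Delta>)))"

end

theory Submission
  imports Defs
begin

text \<open>
  Every rule can be read with its principal formula kept in the premisses, so derivability depends
  only on the sets of formulae occurring in the components, and by weakening both premisses of a
  cut may be given the same context. Cut is proved by induction on the cut formula in a form that
  allows further components after the one with the right occurrence. An induction on the
  derivation of the right occurrence permutes the cut up to a rule introducing the formula in the
  last component; an induction on the other derivation then treats the left occurrence. A boxed cut
  formula introduced by the first right rule may be unfolded into the preceding component, which
  erases the component of the cut; there the extra premiss of the right rule supplies the cut on
  the smaller formula, and this is why components after the cut must be allowed.
\<close>

section \<open>Uniform notation for the two boxes\<close>

fun flip :: "nesting \<Rightarrow> nesting" where
  "flip Fwd = Bwd"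
| "flip Bwd = Fwd"

text \<open>Indexing the boxes by nesting operators turns each white rule and its black mirror image
  into one rule.\<close>

fun bx :: "nesting \<Rightarrow> 'p fm \<Rightarrow> 'p fm" where
  "bx Fwd A = Box A"
| "bx Bwd A = BBox A"

lemma bx_inject [simp]: "bx d A = bx e B \<longleftrightarrow> d = e \<and> A = B"
  by (cases d; cases e) auto

lemma bx_neq [simp]: "bx d A \<noteq> Imp B C" "bx d A \<noteq> Atom p" "bx d A \<noteq> Bot"
  "Imp B C \<noteq> bx d A" "Atom p \<noteq> bx d A" "Bot \<noteq> bx d A"
  by (cases d; simp)+

lemma bx_eq_box [simp]:
  "bx e B = Box A \<longleftrightarrow> e = Fwd \<and> B = A" "bx e B = BBox A \<longleftrightarrow> e = Bwd \<and> B = A"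
  "Box A = bx e B \<longleftrightarrow> e = Fwd \<and> B = A" "BBox A = bx e B \<longleftrightarrow> e = Bwd \<and> B = A"
  "bx e B \<noteq> Dia A" "bx e B \<noteq> BDia A" "Dia A \<noteq> bx e B" "BDia A \<noteq> bx e B"
  by (cases e; auto)+

lemma flip_neq [simp]: "flip d \<noteq> d" "d \<noteq> flip d"
  by (cases d; simp)+

lemma flip_flip [simp]: "flip (flip d) = d"
  by (cases d) simp_all

section \<open>A calculus on lists of components, and weakening\<close>

text \<open>
  Components are listed from the last to the first, each with the nesting operator preceding it.
  The operator of the first component has no meaning.
\<close>

type_synonym 'p comps = "(nesting \<times> 'p fm set \<times> 'p fm set) list"

text \<open>Principal formulae are found by membership, and sets identify repeated formulae, so
  contraction is built in. The disjunct \<open>G = []\<close> in \<open>bxR2\<close> covers a first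
  component, whose recorded operator must not restrict the rule.\<close>

inductive der :: "'p comps \<Rightarrow> bool" where
  id: "Atom p \<in> \<Gamma> \<Longrightarrow> Atom p \<in> \<Delta> \<Longrightarrow> der ((d, \<Gamma>, \<Delta>) # G)"
| botL: "Bot \<in> \<Gamma> \<Longrightarrow> der ((d, \<Gamma>, \<Delta>) # G)"
| ew: "der G \<Longrightarrow> der (x # G)"
| impR: "Imp A B \<in> \<Delta> \<Longrightarrow> der ((d, insert A \<Gamma>, insert B \<Delta>) # G) \<Longrightarrow> der ((d, \<Gamma>, \<Delta>) # G)"
| impL: "Imp A B \<in> \<Gamma> \<Longrightarrow> der ((d, insert B \<Gamma>, \<Delta>) # G) \<Longrightarrow> der ((d, \<Gamma>, insert A \<Delta>) # G) \<Longrightarrow>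
    der ((d, \<Gamma>, \<Delta>) # G)"
| bxR1: "bx (flip e) A \<in> \<Delta> \<Longrightarrow> der ((e, \<Gamma>, \<Delta>) # (d, \<Gamma>', insert A \<Delta>') # G) \<Longrightarrow>
    der ((flip e, {}, {A}) # (e, \<Gamma>, \<Delta>) # (d, \<Gamma>', \<Delta>') # G) \<Longrightarrow>
    der ((e, \<Gamma>, \<Delta>) # (d, \<Gamma>', \<Delta>') # G)"
| bxR2: "bx e A \<in> \<Delta> \<Longrightarrow> G = [] \<or> d = e \<Longrightarrow> der ((e, {}, {A}) # (d, \<Gamma>, \<Delta>) # G) \<Longrightarrow>
    der ((d, \<Gamma>, \<Delta>) # G)"
| bxL1: "bx e A \<in> \<Gamma>' \<Longrightarrow> der ((e, insert A \<Gamma>, \<Delta>) # (d, \<Gamma>', \<Delta>') # G) \<Longrightarrow>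
    der ((e, \<Gamma>, \<Delta>) # (d, \<Gamma>', \<Delta>') # G)"
| bxL2: "bx (flip e) A \<in> \<Gamma> \<Longrightarrow> der ((d, insert A \<Gamma>', \<Delta>') # G) \<Longrightarrow>
    der ((e, \<Gamma>, \<Delta>) # (d, \<Gamma>', \<Delta>') # G)"

abbreviation le_comp :: "nesting \<times> 'p fm set \<times> 'p fm set \<Rightarrow> nesting \<times> 'p fm set \<times> 'p fm set \<Rightarrow> bool" where
  "le_comp x y \<equiv> fst x = fst y \<and> fst (snd x) \<subseteq> fst (snd y) \<and> snd (snd x) \<subseteq> snd (snd y)"

abbreviation le :: "'p comps \<Rightarrow> 'p comps \<Rightarrow> bool" where
  "le \<equiv> list_all2 le_comp"

lemma le_refl [simp]: "le X X"
  by (simp add: list.rel_refl)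

text \<open>Membership conditions survive the enlargement of the sets. The side condition of
  \<open>bxR2\<close> survives as well, because \<open>le\<close> fixes both the operators and the
  number of components.\<close>

lemma weakening: "der X \<Longrightarrow> le X Y \<Longrightarrow> der Y"
proof (induction arbitrary: Y rule: der.induct)
  case (id p \<Gamma> \<Delta> d G)
  then show ?case by (auto simp: list_all2_Cons1 intro!: der.id)
next
  case (botL \<Gamma> d \<Delta> G)
  then show ?case by (auto simp: list_all2_Cons1 intro!: der.botL)
next
  case (ew G x)
  then show ?case by (auto simp: list_all2_Cons1 intro!: der.ew)
next
  case (impR A B \<Delta> d \<Gamma> G)
  from impR.prems obtain \<Gamma>1 \<Delta>1 G1 where Y: "Y = (d, \<Gamma>1, \<Delta>1) # G1" and
    l: "\<Gamma> \<subseteq> \<Gamma>1" "\<Delta> \<subseteq> \<Delta>1" "le G G1" by (auto simp: list_all2_Cons1)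
  show ?case unfolding Y
    by (rule der.impR[of A B]) (use l impR.hyps in \<open>auto intro!: impR.IH\<close>)
next
  case (impL A B \<Gamma> d \<Delta> G)
  from impL.prems obtain \<Gamma>1 \<Delta>1 G1 where Y: "Y = (d, \<Gamma>1, \<Delta>1) # G1" and
    l: "\<Gamma> \<subseteq> \<Gamma>1" "\<Delta> \<subseteq> \<Delta>1" "le G G1" by (auto simp: list_all2_Cons1)
  show ?case unfolding Y
  proof (rule der.impL[of A B])
    show "Imp A B \<in> \<Gamma>1" using l impL.hyps by auto
    show "der ((d, insert B \<Gamma>1, \<Delta>1) # G1)" by (rule impL.IH) (use l in auto)
    show "der ((d, \<Gamma>1, insert A \<Delta>1) # G1)" by (rule impL.IH) (use l in auto)
  qed
next
  case (bxR1 e A \<Delta> \<Gamma> d \<Gamma>' \<Delta>' G)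
  from bxR1.prems obtain \<Gamma>1 \<Delta>1 \<Gamma>2 \<Delta>2 G1 where Y: "Y = (e, \<Gamma>1, \<Delta>1) # (d, \<Gamma>2, \<Delta>2) # G1" and
    l: "\<Gamma> \<subseteq> \<Gamma>1" "\<Delta> \<subseteq> \<Delta>1" "\<Gamma>' \<subseteq> \<Gamma>2" "\<Delta>' \<subseteq> \<Delta>2" "le G G1" by (auto simp: list_all2_Cons1)
  show ?case unfolding Y
  proof (rule der.bxR1[of e A])
    show "bx (flip e) A \<in> \<Delta>1" using l bxR1.hyps by auto
    show "der ((e, \<Gamma>1, \<Delta>1) # (d, \<Gamma>2, insert A \<Delta>2) # G1)" by (rule bxR1.IH) (use l in auto)
    show "der ((flip e, {}, {A}) # (e, \<Gamma>1, \<Delta>1) # (d, \<Gamma>2, \<Delta>2) # G1)"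
      by (rule bxR1.IH) (use l in auto)
  qed
next
  case (bxR2 e A \<Delta> G d \<Gamma>)
  from bxR2.prems obtain \<Gamma>1 \<Delta>1 G1 where Y: "Y = (d, \<Gamma>1, \<Delta>1) # G1" and
    l: "\<Gamma> \<subseteq> \<Gamma>1" "\<Delta> \<subseteq> \<Delta>1" "le G G1" by (auto simp: list_all2_Cons1)
  show ?case unfolding Y
    by (rule der.bxR2[of e A]) (use l bxR2.hyps in \<open>auto intro!: bxR2.IH\<close>)
next
  case (bxL1 e A \<Gamma>' \<Gamma> \<Delta> d \<Delta>' G)
  from bxL1.prems obtain \<Gamma>1 \<Delta>1 \<Gamma>2 \<Delta>2 G1 where Y: "Y = (e, \<Gamma>1, \<Delta>1) # (d, \<Gamma>2, \<Delta>2) # G1" and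
    l: "\<Gamma> \<subseteq> \<Gamma>1" "\<Delta> \<subseteq> \<Delta>1" "\<Gamma>' \<subseteq> \<Gamma>2" "\<Delta>' \<subseteq> \<Delta>2" "le G G1" by (auto simp: list_all2_Cons1)
  show ?case unfolding Y
    by (rule der.bxL1[of _ A]) (use l bxL1.hyps in \<open>auto intro!: bxL1.IH\<close>)
next
  case (bxL2 e A \<Gamma> d \<Gamma>' \<Delta>' G \<Delta>)
  from bxL2.prems obtain \<Gamma>1 \<Delta>1 \<Gamma>2 \<Delta>2 G1 where Y: "Y = (e, \<Gamma>1, \<Delta>1) # (d, \<Gamma>2, \<Delta>2) # G1" and
    l: "\<Gamma> \<subseteq> \<Gamma>1" "\<Delta> \<subseteq> \<Delta>1" "\<Gamma>' \<subseteq> \<Gamma>2" "\<Delta>' \<subseteq> \<Delta>2" "le G G1" by (auto simp: list_all2_Cons1)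
  show ?case unfolding Y
    by (rule der.bxL2[of _ A]) (use l bxL2.hyps in \<open>auto intro!: bxL2.IH\<close>)
qed

section \<open>Cuts against a formula just introduced on the right\<close>

text \<open>Only the derivation with \<open>A\<close> on the right may continue with components
  \<open>I\<close> after the cut; the other one ends at the component of the cut.\<close>

definition cut_admissible :: "'p fm \<Rightarrow> bool" where
  "cut_admissible A \<longleftrightarrow> (\<forall>I d \<Gamma> \<Delta> G. der (I @ (d, \<Gamma>, insert A \<Delta>) # G) \<longrightarrow>
     der ((d, insert A \<Gamma>, \<Delta>) # G) \<longrightarrow> der (I @ (d, \<Gamma>, \<Delta>) # G))"

lemma cut_admissibleD:
  "cut_admissible A \<Longrightarrow> der (I @ (d, \<Gamma>, insert A \<Delta>) # G) \<Longrightarrow> der ((d, insert A \<Gamma>, \<Delta>) # G) \<Longrightarrow>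
    der (I @ (d, \<Gamma>, \<Delta>) # G)"
  unfolding cut_admissible_def by blast

lemmas cut_admissible_last = cut_admissibleD[where I = "[]", simplified]

text \<open>
  The premisses of a rule introducing the formula on the right of the last component, with the kept
  copy of the formula already cut away.
\<close>

inductive introduced :: "'p fm \<Rightarrow> nesting \<Rightarrow> 'p fm set \<Rightarrow> 'p fm set \<Rightarrow> 'p comps \<Rightarrow> bool" where
  atom: "Atom p \<in> \<Gamma> \<Longrightarrow> introduced (Atom p) d \<Gamma> \<Delta> G"
| imp: "cut_admissible A \<Longrightarrow> cut_admissible B \<Longrightarrow> der ((d, insert A \<Gamma>, insert B \<Delta>) # G) \<Longrightarrow>
    introduced (Imp A B) d \<Gamma> \<Delta> G"
| box1: "cut_admissible A \<Longrightarrow> der ((e, \<Gamma>, \<Delta>) # (d, \<Gamma>', insert A \<Delta>') # G) \<Longrightarrow>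
    der ((flip e, {}, {A}) # (e, \<Gamma>, \<Delta>) # (d, \<Gamma>', \<Delta>') # G) \<Longrightarrow>
    introduced (bx (flip e) A) e \<Gamma> \<Delta> ((d, \<Gamma>', \<Delta>') # G)"
| box2: "cut_admissible A \<Longrightarrow> G = [] \<or> d = e \<Longrightarrow> der ((e, {}, {A}) # (d, \<Gamma>, \<Delta>) # G) \<Longrightarrow>
    introduced (bx e A) d \<Gamma> \<Delta> G"

text \<open>The recorded premisses can be weakened along with the context. This is needed when a cut
  is permuted above a rule that adds formulae to the component of the cut or to an earlier
  one.\<close>

lemma introduced_mono:
  assumes "introduced A d \<Gamma> \<Delta> G" "\<Gamma> \<subseteq> \<Gamma>1" "\<Delta> \<subseteq> \<Delta>1" "le G G1"
  shows "introduced A d \<Gamma>1 \<Delta>1 G1"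
  using assms
proof cases
  case (atom p)
  then show ?thesis using assms by (auto intro: introduced.atom)
next
  case (imp A B)
  then show ?thesis using assms
    by (auto intro!: introduced.imp elim!: weakening)
next
  case (box1 B d' \<Gamma>' \<Delta>' G')
  with assms obtain \<Gamma>2 \<Delta>2 G2 where G1: "G1 = (d', \<Gamma>2, \<Delta>2) # G2"
    and l: "\<Gamma>' \<subseteq> \<Gamma>2" "\<Delta>' \<subseteq> \<Delta>2" "le G' G2" by (auto simp: list_all2_Cons1)
  show ?thesis unfolding box1(1) G1
    by (rule introduced.box1; (rule box1(3) weakening[OF box1(4)] weakening[OF box1(5)])?)
      (use l assms in auto)
next
  case (box2 A e)
  then show ?thesis using assms
    by (auto intro!: introduced.box2 elim!: weakening)
qed

text \<open>Both right rules for a box share the premiss with a fresh component, which is all that a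
  propagation of \<open>B\<close> into the next component requires.\<close>

lemma introduced_bx:
  assumes "introduced (bx e B) d \<Gamma> \<Delta> G"
  shows "cut_admissible B" "der ((e, {}, {B}) # (d, \<Gamma>, \<Delta>) # G)"
  using assms by (cases rule: introduced.cases; simp)+

text \<open>Induction on the derivation with \<open>A\<close> on the left. Components
  \<open>J\<close> after the cut are needed because right box rules open new ones when read upwards.
  The left occurrence can be principal in \<open>id\<close>, \<open>impL\<close>,
  \<open>bxL1\<close> and \<open>bxL2\<close> only, as \<open>introduced\<close> has no case for
  \<open>Bot\<close>.\<close>

lemma cut_introduced:
  assumes "der X" "X = J @ (d, insert A \<Gamma>, \<Delta>) # G" "introduced A d \<Gamma> \<Delta> G"
  shows "der (J @ (d, \<Gamma>, \<Delta>) # G)"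
  using assms
proof (induction arbitrary: J d \<Gamma> \<Delta> G rule: der.induct)
  case (id p \<Gamma>0 \<Delta>0 d0 G0)
  show ?case
  proof (cases J)
    case Nil
    \<comment> \<open>If the cut formula is this atom, \<open>introduced\<close> says that it occurs
      in \<open>\<Gamma>\<close> anyway, so the axiom remains.\<close>
    with id show ?thesis by (auto intro: der.id elim: introduced.cases)
  next
    case (Cons y J')
    with id show ?thesis by (auto intro: der.id)
  qed
next
  case (botL \<Gamma>0 d0 \<Delta>0 G0)
  show ?case
  proof (cases J)
    case Nil
    with botL show ?thesis by (auto intro: der.botL elim: introduced.cases)
  next
    case (Cons y J')
    with botL show ?thesis by (auto intro: der.botL)
  qed
next
  case (ew G0 x)
  then show ?case by (cases J) (auto intro: der.ew)
next
  case (impR B C \<Delta>0 d0 \<Gamma>0 G0)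
  show ?case
  proof (cases J)
    case Nil
    with impR.prems have eq: "d0 = d" "\<Gamma>0 = insert A \<Gamma>" "\<Delta>0 = \<Delta>" "G0 = G" by auto
    have "der ([] @ (d, insert B \<Gamma>, insert C \<Delta>) # G)"
      by (rule impR.IH) (auto simp: eq insert_commute intro!: introduced_mono[OF impR.prems(2)])
    with impR.hyps Nil eq show ?thesis by (auto intro: der.impR)
  next
    case (Cons y J')
    with impR.prems have eq: "y = (d0, \<Gamma>0, \<Delta>0)" "G0 = J' @ (d, insert A \<Gamma>, \<Delta>) # G" by auto
    have "der (((d0, insert B \<Gamma>0, insert C \<Delta>0) # J') @ (d, \<Gamma>, \<Delta>) # G)"
      by (rule impR.IH) (auto simp: eq impR.prems)
    with impR.hyps Cons eq show ?thesis by (auto intro: der.impR)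
  qed
next
  case (impL B C \<Gamma>0 d0 \<Delta>0 G0)
  show ?case
  proof (cases J)
    case Nil
    with impL.prems have eq: "d0 = d" "\<Gamma>0 = insert A \<Gamma>" "\<Delta>0 = \<Delta>" "G0 = G" by auto
    have 1: "der ([] @ (d, insert C \<Gamma>, \<Delta>) # G)"
      by (rule impL.IH) (auto simp: eq insert_commute intro!: introduced_mono[OF impL.prems(2)])
    have 2: "der ([] @ (d, \<Gamma>, insert B \<Delta>) # G)"
      by (rule impL.IH) (auto simp: eq insert_commute intro!: introduced_mono[OF impL.prems(2)])
    show ?thesis
    proof (cases "Imp B C = A")
      case True
      \<comment> \<open>Principal case: a cut on \<open>B\<close> between \<open>2\<close> and the
        introduction premiss, followed by a cut on \<open>C\<close> against
        \<open>1\<close>.\<close>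
      from impL.prems(2) have c: "cut_admissible B" "cut_admissible C"
        "der ((d, insert B \<Gamma>, insert C \<Delta>) # G)"
        unfolding True[symmetric] by (auto elim: introduced.cases)
      have "der ((d, \<Gamma>, insert C \<Delta>) # G)"
        by (rule cut_admissible_last[OF c(1) _ c(3)]) (auto intro!: weakening[OF 2])
      from cut_admissible_last[OF c(2) this] 1 Nil show ?thesis by simp
    next
      case False
      with impL.hyps eq have "Imp B C \<in> \<Gamma>" by auto
      with 1 2 Nil show ?thesis by (auto intro: der.impL)
    qed
  next
    case (Cons y J')
    with impL.prems have eq: "y = (d0, \<Gamma>0, \<Delta>0)" "G0 = J' @ (d, insert A \<Gamma>, \<Delta>) # G" by auto
    have "der (((d0, insert C \<Gamma>0, \<Delta>0) # J') @ (d, \<Gamma>, \<Delta>) # G)"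
      by (rule impL.IH) (auto simp: eq impL.prems)
    moreover have "der (((d0, \<Gamma>0, insert B \<Delta>0) # J') @ (d, \<Gamma>, \<Delta>) # G)"
      by (rule impL.IH) (auto simp: eq impL.prems)
    ultimately show ?thesis using impL.hyps Cons eq by (auto intro: der.impL)
  qed
next
  case (bxR1 e B \<Delta>0 \<Gamma>0 d0 \<Gamma>' \<Delta>' G0)
  \<comment> \<open>A rule on two components meets the cut in its last component, in the one before
    it, or in neither.\<close>
  consider "J = []" | y where "J = [y]" | y z J' where "J = y # z # J'"
    by (metis neq_Nil_conv)
  then show ?case
  proof cases
    case 1
    with bxR1.prems have eq: "e = d" "\<Gamma>0 = insert A \<Gamma>" "\<Delta>0 = \<Delta>" "G = (d0, \<Gamma>', \<Delta>') # G0" by auto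
    have a: "der ([] @ (d, \<Gamma>, \<Delta>) # (d0, \<Gamma>', insert B \<Delta>') # G0)"
      by (rule bxR1.IH) (auto simp: eq intro!: introduced_mono[OF bxR1.prems(2)])
    have b: "der ([(flip d, {}, {B})] @ (d, \<Gamma>, \<Delta>) # G)"
      by (rule bxR1.IH) (auto simp: eq intro!: introduced_mono[OF bxR1.prems(2)])
    show ?thesis using bxR1.hyps a b by (auto simp: eq 1 intro: der.bxR1)
  next
    case (2 y)
    with bxR1.prems have eq: "y = (e, \<Gamma>0, \<Delta>0)" "d0 = d" "\<Gamma>' = insert A \<Gamma>" "\<Delta>' = \<Delta>" "G = G0" by auto
    have a: "der ([y] @ (d, \<Gamma>, insert B \<Delta>) # G)"
      by (rule bxR1.IH) (auto simp: eq intro!: introduced_mono[OF bxR1.prems(2)])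
    have b: "der ([(flip e, {}, {B}), y] @ (d, \<Gamma>, \<Delta>) # G)"
      by (rule bxR1.IH) (auto simp: eq intro!: introduced_mono[OF bxR1.prems(2)])
    show ?thesis using bxR1.hyps a b by (auto simp: eq 2 intro: der.bxR1)
  next
    case (3 y z J')
    with bxR1.prems have eq: "y = (e, \<Gamma>0, \<Delta>0)" "z = (d0, \<Gamma>', \<Delta>')"
      "G0 = J' @ (d, insert A \<Gamma>, \<Delta>) # G" by auto
    have a: "der ((y # (d0, \<Gamma>', insert B \<Delta>') # J') @ (d, \<Gamma>, \<Delta>) # G)"
      by (rule bxR1.IH) (auto simp: eq bxR1.prems)
    have b: "der (((flip e, {}, {B}) # y # z # J') @ (d, \<Gamma>, \<Delta>) # G)"
      by (rule bxR1.IH) (auto simp: eq bxR1.prems)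
    show ?thesis using bxR1.hyps a b by (auto simp: eq 3 intro: der.bxR1)
  qed
next
  case (bxR2 e B \<Delta>0 G0 d0 \<Gamma>0)
  show ?case
  proof (cases J)
    case Nil
    with bxR2.prems have eq: "d0 = d" "\<Gamma>0 = insert A \<Gamma>" "\<Delta>0 = \<Delta>" "G0 = G" by auto
    have "der ([(e, {}, {B})] @ (d, \<Gamma>, \<Delta>) # G)"
      by (rule bxR2.IH) (auto simp: eq bxR2.prems)
    with bxR2.hyps Nil eq show ?thesis by (auto intro: der.bxR2)
  next
    case (Cons y J')
    with bxR2.prems have eq: "y = (d0, \<Gamma>0, \<Delta>0)" "G0 = J' @ (d, insert A \<Gamma>, \<Delta>) # G" by auto
    have "der (((e, {}, {B}) # y # J') @ (d, \<Gamma>, \<Delta>) # G)"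
      by (rule bxR2.IH) (auto simp: eq bxR2.prems)
    with bxR2.hyps Cons eq show ?thesis by (auto intro: der.bxR2)
  qed
next
  case (bxL1 e B \<Gamma>' \<Gamma>0 \<Delta>0 d0 \<Delta>' G0)
  consider "J = []" | y where "J = [y]" | y z J' where "J = y # z # J'"
    by (metis neq_Nil_conv)
  then show ?case
  proof cases
    case 1
    with bxL1.prems have eq: "e = d" "\<Gamma>0 = insert A \<Gamma>" "\<Delta>0 = \<Delta>" "G = (d0, \<Gamma>', \<Delta>') # G0" by auto
    have "der ([] @ (d, insert B \<Gamma>, \<Delta>) # G)"
      by (rule bxL1.IH) (auto simp: eq insert_commute intro!: introduced_mono[OF bxL1.prems(2)])
    then show ?thesis using bxL1.hyps by (auto simp: eq 1 intro: der.bxL1)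
  next
    case (2 y)
    with bxL1.prems have eq: "y = (e, \<Gamma>0, \<Delta>0)" "d0 = d" "\<Gamma>' = insert A \<Gamma>" "\<Delta>' = \<Delta>" "G = G0" by auto
    have a: "der ([(e, insert B \<Gamma>0, \<Delta>0)] @ (d, \<Gamma>, \<Delta>) # G)"
      by (rule bxL1.IH) (auto simp: eq intro!: introduced_mono[OF bxL1.prems(2)])
    show ?thesis
    proof (cases "bx e B = A")
      case True
      \<comment> \<open>The box has sent \<open>B\<close> into the component after the cut.
        Weakening the fresh component of the introduction premiss to the contents of
        \<open>y\<close> leaves a cut on \<open>B\<close> in that last component.\<close>
      note i = introduced_bx[OF bxL1.prems(2)[folded True]]
      have "der ((e, \<Gamma>0, insert B \<Delta>0) # (d, \<Gamma>, \<Delta>) # G)"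
        by (rule weakening[OF i(2)]) auto
      from cut_admissible_last[OF i(1) this] a show ?thesis by (simp add: 2 eq)
    next
      case False
      with bxL1.hyps eq have "bx e B \<in> \<Gamma>" by auto
      with a show ?thesis by (auto simp: eq 2 intro: der.bxL1)
    qed
  next
    case (3 y z J')
    with bxL1.prems have eq: "y = (e, \<Gamma>0, \<Delta>0)" "z = (d0, \<Gamma>', \<Delta>')"
      "G0 = J' @ (d, insert A \<Gamma>, \<Delta>) # G" by auto
    have "der (((e, insert B \<Gamma>0, \<Delta>0) # z # J') @ (d, \<Gamma>, \<Delta>) # G)"
      by (rule bxL1.IH) (auto simp: eq bxL1.prems)
    then show ?thesis using bxL1.hyps by (auto simp: eq 3 intro: der.bxL1)
  qed
next
  case (bxL2 e B \<Gamma>0 d0 \<Gamma>' \<Delta>' G0 \<Delta>0)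
  consider "J = []" | y where "J = [y]" | y z J' where "J = y # z # J'"
    by (metis neq_Nil_conv)
  then show ?case
  proof cases
    case 1
    with bxL2.prems have eq: "e = d" "\<Gamma>0 = insert A \<Gamma>" "\<Delta>0 = \<Delta>" "G = (d0, \<Gamma>', \<Delta>') # G0" by auto
    show ?thesis
    proof (cases "bx (flip e) B = A")
      case True
      \<comment> \<open>The rule has erased the component of the cut. Since there is a preceding
        component and \<open>flip d\<close> differs from \<open>d\<close>, the box can only come
        from \<open>box1\<close>, whose first premiss has \<open>B\<close> on the right of that
        preceding component, with one component still after it.\<close>
      have "cut_admissible B \<and> der ([(d, \<Gamma>, \<Delta>)] @ (d0, \<Gamma>', insert B \<Delta>') # G0)"
        using bxL2.prems(2) unfolding True[symmetric] eq by (cases rule: introduced.cases) auto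
      then show ?thesis using cut_admissibleD[of B "[(d, \<Gamma>, \<Delta>)]"] bxL2.hyps by (simp add: 1 eq)
    next
      case False
      \<comment> \<open>The premiss no longer contains the component of the cut, so the rule applies
        again directly.\<close>
      with bxL2.hyps eq have "bx (flip d) B \<in> \<Gamma>" by auto
      with bxL2.hyps show ?thesis by (auto simp: eq 1 intro: der.bxL2)
    qed
  next
    case (2 y)
    with bxL2.prems have eq: "y = (e, \<Gamma>0, \<Delta>0)" "d0 = d" "\<Gamma>' = insert A \<Gamma>" "\<Delta>' = \<Delta>" "G = G0" by auto
    have "der ([] @ (d, insert B \<Gamma>, \<Delta>) # G)"
      by (rule bxL2.IH) (auto simp: eq insert_commute intro!: introduced_mono[OF bxL2.prems(2)])
    with bxL2.hyps show ?thesis by (auto simp: eq 2 intro: der.bxL2)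
  next
    case (3 y z J')
    with bxL2.prems have eq: "y = (e, \<Gamma>0, \<Delta>0)" "z = (d0, \<Gamma>', \<Delta>')"
      "G0 = J' @ (d, insert A \<Gamma>, \<Delta>) # G" by auto
    have "der (((d0, insert B \<Gamma>', \<Delta>') # J') @ (d, \<Gamma>, \<Delta>) # G)"
      by (rule bxL2.IH) (auto simp: eq bxL2.prems)
    then show ?thesis using bxL2.hyps by (auto simp: eq 3 intro: der.bxL2)
  qed
qed

section \<open>Permuting the right occurrence, and induction on the cut formula\<close>

text \<open>Induction on the derivation with \<open>A\<close> on the right, the other derivation
  being weakened whenever the component of the cut or its context grows. If \<open>A\<close> is
  principal on the right, it stands in the last component; the induction hypotheses remove its kept
  copies, and \<open>cut_introduced\<close> finishes with \<open>J\<close> empty.\<close>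

lemma cut_admissible_step:
  assumes sub: "\<And>B C. A = Imp B C \<Longrightarrow> cut_admissible B \<and> cut_admissible C"
    "\<And>e B. A = bx e B \<Longrightarrow> cut_admissible B"
  shows "cut_admissible A"
proof -
  have "der (J @ (d, \<Gamma>, \<Delta>) # G)"
    if "der X" "X = J @ (d, \<Gamma>, insert A \<Delta>) # G" "der ((d, insert A \<Gamma>, \<Delta>) # G)" for X J d \<Gamma> \<Delta> G
    using that
  proof (induction arbitrary: J d \<Gamma> \<Delta> G rule: der.induct)
    case (id p \<Gamma>0 \<Delta>0 d0 G0)
    show ?case
    proof (cases J)
      case Nil
      with id.prems have eq: "d0 = d" "\<Gamma>0 = \<Gamma>" "\<Delta>0 = insert A \<Delta>" "G0 = G" by auto
      show ?thesis
      proof (cases "Atom p = A")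
        case True
        then have "introduced A d \<Gamma> \<Delta> G" using id.hyps eq by (auto intro: introduced.atom)
        from cut_introduced[OF id.prems(2), of "[]", OF _ this] Nil show ?thesis by simp
      qed (use id.hyps eq Nil in \<open>auto intro: der.id\<close>)
    next
      case (Cons y J')
      with id show ?thesis by (auto intro: der.id)
    qed
  next
    case (botL \<Gamma>0 d0 \<Delta>0 G0)
    then show ?case by (cases J) (auto intro: der.botL)
  next
    case (ew G0 x)
    then show ?case by (cases J) (auto intro: der.ew)
  next
    case (impR B C \<Delta>0 d0 \<Gamma>0 G0)
    show ?case
    proof (cases J)
      case Nil
      with impR.prems have eq: "d0 = d" "\<Gamma>0 = \<Gamma>" "\<Delta>0 = insert A \<Delta>" "G0 = G" by auto
      have 1: "der ([] @ (d, insert B \<Gamma>, insert C \<Delta>) # G)"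
        by (rule impR.IH) (auto simp: eq insert_commute intro!: weakening[OF impR.prems(2)])
      show ?thesis
      proof (cases "Imp B C = A")
        case True
        then have "introduced A d \<Gamma> \<Delta> G" using sub(1)[of B C] 1 by (auto intro: introduced.imp)
        from cut_introduced[OF impR.prems(2), of "[]", OF _ this] Nil show ?thesis by simp
      next
        case False
        with impR.hyps 1 Nil eq show ?thesis by (auto intro: der.impR)
      qed
    next
      case (Cons y J')
      with impR.prems have eq: "y = (d0, \<Gamma>0, \<Delta>0)" "G0 = J' @ (d, \<Gamma>, insert A \<Delta>) # G" by auto
      have "der (((d0, insert B \<Gamma>0, insert C \<Delta>0) # J') @ (d, \<Gamma>, \<Delta>) # G)"
        by (rule impR.IH) (auto simp: eq impR.prems)
      with impR.hyps Cons eq show ?thesis by (auto intro: der.impR)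
    qed
  next
    case (impL B C \<Gamma>0 d0 \<Delta>0 G0)
    show ?case
    proof (cases J)
      case Nil
      with impL.prems have eq: "d0 = d" "\<Gamma>0 = \<Gamma>" "\<Delta>0 = insert A \<Delta>" "G0 = G" by auto
      have 1: "der ([] @ (d, insert C \<Gamma>, \<Delta>) # G)"
        by (rule impL.IH) (auto simp: eq insert_commute intro!: weakening[OF impL.prems(2)])
      have 2: "der ([] @ (d, \<Gamma>, insert B \<Delta>) # G)"
        by (rule impL.IH) (auto simp: eq insert_commute intro!: weakening[OF impL.prems(2)])
      from 1 2 Nil impL.hyps show ?thesis by (auto simp: eq intro: der.impL)
    next
      case (Cons y J')
      with impL.prems have eq: "y = (d0, \<Gamma>0, \<Delta>0)" "G0 = J' @ (d, \<Gamma>, insert A \<Delta>) # G" by auto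
      have "der (((d0, insert C \<Gamma>0, \<Delta>0) # J') @ (d, \<Gamma>, \<Delta>) # G)"
        by (rule impL.IH) (auto simp: eq impL.prems)
      moreover have "der (((d0, \<Gamma>0, insert B \<Delta>0) # J') @ (d, \<Gamma>, \<Delta>) # G)"
        by (rule impL.IH) (auto simp: eq impL.prems)
      ultimately show ?thesis using impL.hyps Cons eq by (auto intro: der.impL)
    qed
  next
    case (bxR1 e B \<Delta>0 \<Gamma>0 d0 \<Gamma>' \<Delta>' G0)
    consider "J = []" | y where "J = [y]" | y z J' where "J = y # z # J'"
      by (metis neq_Nil_conv)
    then show ?case
    proof cases
      case 1
      with bxR1.prems have eq: "e = d" "\<Gamma>0 = \<Gamma>" "\<Delta>0 = insert A \<Delta>" "G = (d0, \<Gamma>', \<Delta>') # G0" by auto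
      have a: "der ([] @ (d, \<Gamma>, \<Delta>) # (d0, \<Gamma>', insert B \<Delta>') # G0)"
        by (rule bxR1.IH) (auto simp: eq intro!: weakening[OF bxR1.prems(2)])
      have b: "der ([(flip d, {}, {B})] @ (d, \<Gamma>, \<Delta>) # G)"
        by (rule bxR1.IH) (auto simp: eq intro!: weakening[OF bxR1.prems(2)])
      show ?thesis
      proof (cases "bx (flip e) B = A")
        case True
        \<comment> \<open>Both premisses are recorded: \<open>b\<close> serves a propagation
          forwards along the list of nestings, \<open>a\<close> an unfolding into the preceding
          component.\<close>
        have "introduced (bx (flip d) B) d \<Gamma> \<Delta> G" unfolding eq(4)
          by (rule introduced.box1) (use a b sub(2)[OF True[symmetric]] eq in auto)
        with True eq have "introduced A d \<Gamma> \<Delta> G" by simp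
        from cut_introduced[OF bxR1.prems(2), of "[]", OF _ this] 1 show ?thesis by simp
      next
        case False
        with bxR1.hyps a b show ?thesis by (auto simp: eq 1 intro: der.bxR1)
      qed
    next
      case (2 y)
      with bxR1.prems have eq: "y = (e, \<Gamma>0, \<Delta>0)" "d0 = d" "\<Gamma>' = \<Gamma>" "\<Delta>' = insert A \<Delta>" "G = G0" by auto
      \<comment> \<open>Here the first premiss puts \<open>B\<close> into the component of the cut
        itself, so the other derivation is weakened by \<open>B\<close>.\<close>
      have a: "der ([y] @ (d, \<Gamma>, insert B \<Delta>) # G)"
        by (rule bxR1.IH) (auto simp: eq insert_commute intro!: weakening[OF bxR1.prems(2)])
      have b: "der ([(flip e, {}, {B}), y] @ (d, \<Gamma>, \<Delta>) # G)"
        by (rule bxR1.IH) (auto simp: eq intro!: weakening[OF bxR1.prems(2)])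
      show ?thesis using bxR1.hyps a b by (auto simp: eq 2 intro: der.bxR1)
    next
      case (3 y z J')
      with bxR1.prems have eq: "y = (e, \<Gamma>0, \<Delta>0)" "z = (d0, \<Gamma>', \<Delta>')"
        "G0 = J' @ (d, \<Gamma>, insert A \<Delta>) # G" by auto
      have a: "der ((y # (d0, \<Gamma>', insert B \<Delta>') # J') @ (d, \<Gamma>, \<Delta>) # G)"
        by (rule bxR1.IH) (auto simp: eq bxR1.prems)
      have b: "der (((flip e, {}, {B}) # y # z # J') @ (d, \<Gamma>, \<Delta>) # G)"
        by (rule bxR1.IH) (auto simp: eq bxR1.prems)
      show ?thesis using bxR1.hyps a b by (auto simp: eq 3 intro: der.bxR1)
    qed
  next
    case (bxR2 e B \<Delta>0 G0 d0 \<Gamma>0)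
    show ?case
    proof (cases J)
      case Nil
      with bxR2.prems have eq: "d0 = d" "\<Gamma>0 = \<Gamma>" "\<Delta>0 = insert A \<Delta>" "G0 = G" by auto
      have 1: "der ([(e, {}, {B})] @ (d, \<Gamma>, \<Delta>) # G)"
        by (rule bxR2.IH) (auto simp: eq bxR2.prems)
      show ?thesis
      proof (cases "bx e B = A")
        case True
        have "introduced (bx e B) d \<Gamma> \<Delta> G"
          by (rule introduced.box2) (use 1 bxR2.hyps sub(2)[OF True[symmetric]] eq in auto)
        with True have "introduced A d \<Gamma> \<Delta> G" by simp
        from cut_introduced[OF bxR2.prems(2), of "[]", OF _ this] Nil show ?thesis by simp
      next
        case False
        with bxR2.hyps Nil eq 1 show ?thesis by (auto intro: der.bxR2)
      qed
    next
      case (Cons y J')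
      with bxR2.prems have eq: "y = (d0, \<Gamma>0, \<Delta>0)" "G0 = J' @ (d, \<Gamma>, insert A \<Delta>) # G" by auto
      have "der (((e, {}, {B}) # y # J') @ (d, \<Gamma>, \<Delta>) # G)"
        by (rule bxR2.IH) (auto simp: eq bxR2.prems)
      with bxR2.hyps Cons eq show ?thesis by (auto intro: der.bxR2)
    qed
  next
    case (bxL1 e B \<Gamma>' \<Gamma>0 \<Delta>0 d0 \<Delta>' G0)
    consider "J = []" | y where "J = [y]" | y z J' where "J = y # z # J'"
      by (metis neq_Nil_conv)
    then show ?case
    proof cases
      case 1
      with bxL1.prems have eq: "e = d" "\<Gamma>0 = \<Gamma>" "\<Delta>0 = insert A \<Delta>" "G = (d0, \<Gamma>', \<Delta>') # G0" by auto
      have "der ([] @ (d, insert B \<Gamma>, \<Delta>) # G)"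
        by (rule bxL1.IH) (auto simp: eq insert_commute intro!: weakening[OF bxL1.prems(2)])
      then show ?thesis using bxL1.hyps by (auto simp: eq 1 intro: der.bxL1)
    next
      case (2 y)
      with bxL1.prems have eq: "y = (e, \<Gamma>0, \<Delta>0)" "d0 = d" "\<Gamma>' = \<Gamma>" "\<Delta>' = insert A \<Delta>" "G = G0" by auto
      have "der ([(e, insert B \<Gamma>0, \<Delta>0)] @ (d, \<Gamma>, \<Delta>) # G)"
        by (rule bxL1.IH) (auto simp: eq intro!: weakening[OF bxL1.prems(2)])
      then show ?thesis using bxL1.hyps by (auto simp: eq 2 intro: der.bxL1)
    next
      case (3 y z J')
      with bxL1.prems have eq: "y = (e, \<Gamma>0, \<Delta>0)" "z = (d0, \<Gamma>', \<Delta>')"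
        "G0 = J' @ (d, \<Gamma>, insert A \<Delta>) # G" by auto
      have "der (((e, insert B \<Gamma>0, \<Delta>0) # z # J') @ (d, \<Gamma>, \<Delta>) # G)"
        by (rule bxL1.IH) (auto simp: eq bxL1.prems)
      then show ?thesis using bxL1.hyps by (auto simp: eq 3 intro: der.bxL1)
    qed
  next
    case (bxL2 e B \<Gamma>0 d0 \<Gamma>' \<Delta>' G0 \<Delta>0)
    consider "J = []" | y where "J = [y]" | y z J' where "J = y # z # J'"
      by (metis neq_Nil_conv)
    then show ?case
    proof cases
      case 1
      \<comment> \<open>The rule discards the component containing \<open>A\<close>, so its
        conclusion holds with any right-hand side there.\<close>
      with bxL2 show ?thesis by (auto intro: der.bxL2)
    next
      case (2 y)
      with bxL2.prems have eq: "y = (e, \<Gamma>0, \<Delta>0)" "d0 = d" "\<Gamma>' = \<Gamma>" "\<Delta>' = insert A \<Delta>" "G = G0" by auto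
      have "der ([] @ (d, insert B \<Gamma>, \<Delta>) # G)"
        by (rule bxL2.IH) (auto simp: eq insert_commute intro!: weakening[OF bxL2.prems(2)])
      with bxL2.hyps show ?thesis by (auto simp: eq 2 intro: der.bxL2)
    next
      case (3 y z J')
      with bxL2.prems have eq: "y = (e, \<Gamma>0, \<Delta>0)" "z = (d0, \<Gamma>', \<Delta>')"
        "G0 = J' @ (d, \<Gamma>, insert A \<Delta>) # G" by auto
      have "der (((d0, insert B \<Gamma>', \<Delta>') # J') @ (d, \<Gamma>, \<Delta>) # G)"
        by (rule bxL2.IH) (auto simp: eq bxL2.prems)
      then show ?thesis using bxL2.hyps by (auto simp: eq 3 intro: der.bxL2)
    qed
  qed
  then show ?thesis unfolding cut_admissible_def by blast
qed

text \<open>For atoms, \<open>Bot\<close> and the two diamonds the assumptions of the step hold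
  vacuously: none of these is an implication or a box.\<close>

lemma cut_admissible: "cut_admissible A"
  by (induction A) (rule cut_admissible_step; simp)+

section \<open>Translation between linear nested sequents and lists\<close>

fun comp_of :: "nesting \<Rightarrow> 'p sequent \<Rightarrow> nesting \<times> 'p fm set \<times> 'p fm set" where
  "comp_of d (\<Gamma> \<Rightarrow>\<^sub>s \<Delta>) = (d, set_mset \<Gamma>, set_mset \<Delta>)"

text \<open>The argument is the operator recorded for the first component; the recursion reverses
  the order, so that the active end becomes the head.\<close>

fun comps :: "nesting \<Rightarrow> 'p lns \<Rightarrow> 'p comps" where
  "comps d (Last s) = [comp_of d s]"
| "comps d (Nest s e S) = comps e S @ [comp_of d s]"

fun ctx_comps :: "'p lns option \<Rightarrow> 'p comps" where
  "ctx_comps None = []"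
| "ctx_comps (Some G) = comps Fwd G"

text \<open>After an empty context the next component is the first one and receives the conventional
  operator \<open>Fwd\<close>.\<close>

fun first_op :: "'p lns option \<Rightarrow> nesting \<Rightarrow> nesting" where
  "first_op None d = Fwd"
| "first_op (Some G) d = d"

lemma comps_append [simp]: "comps e (append_lns G d S) = comps d S @ comps e G"
  by (induction G arbitrary: e) auto

lemma comps_plug [simp]: "comps Fwd (plug G d S) = comps (first_op G d) S @ ctx_comps G"
  by (cases G) auto

lemma derivable_imp_der: "derivable S \<Longrightarrow> der (comps Fwd S)"
proof (induction rule: derivable.induct)
  case (BoxR1 G d \<Gamma> A \<Delta> \<Sigma> \<Pi>)
  then show ?case using der.bxR1[of Bwd A] by simp
next
  case (BBoxR1 G d \<Gamma> A \<Delta> \<Sigma> \<Pi>)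
  then show ?case using der.bxR1[of Fwd A] by simp
next
  case (BoxR2 G \<Gamma> A \<Delta>)
  then show ?case using der.bxR2[of Fwd A] by (cases G) simp_all
next
  case (BBoxR2 G \<Gamma> A \<Delta>)
  \<comment> \<open>With an empty context the recorded operator is \<open>Fwd\<close> although the
    box is black; the disjunct for an empty context permits this.\<close>
  then show ?case using der.bxR2[of Bwd A] by (cases G) simp_all
next
  case (BoxL1 G d A \<Gamma> \<Delta> \<Sigma> \<Pi>)
  then show ?case using der.bxL1[of Fwd A] by simp
next
  case (BBoxL1 G d A \<Gamma> \<Delta> \<Sigma> \<Pi>)
  then show ?case using der.bxL1[of Bwd A] by simp
next
  case (BoxL2 G d A \<Gamma> \<Delta> \<Sigma> \<Pi>)
  then show ?case using der.bxL2[of Bwd A] by simp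
next
  case (BBoxL2 G d A \<Gamma> \<Delta> \<Sigma> \<Pi>)
  then show ?case using der.bxL2[of Fwd A] by simp
next
  case (Id G d p \<Gamma> \<Delta>)
  show ?case using der.id[of p] by simp
next
  case (BotL G d \<Gamma> \<Delta>)
  show ?case by (simp add: der.botL)
next
  case (EW G d \<Gamma> \<Delta>)
  then show ?case using der.ew by simp
next
  case (ImpR G d A \<Gamma> B \<Delta>)
  then show ?case using der.impR[of A B] by (simp add: insert_commute)
next
  case (ImpL G d A B \<Gamma> \<Delta>)
  then show ?case using der.impL[of A B] by (simp add: insert_commute)
qed

text \<open>The datatype exposes the first component, whereas the rules act on the last.\<close>

lemma lns_cases_last: obtains G d s where "S = plug G d (Last s)"
proof (induction S arbitrary: thesis)
  case (Last s)
  show ?case by (rule Last[of None Fwd s]) simp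
next
  case (Nest s e S)
  obtain G d s' where "S = plug G d (Last s')" using Nest.IH by blast
  then show ?case
    by (cases G) (auto intro: Nest.prems[of "Some (Last s)" e s']
        Nest.prems[of "Some (Nest s e _)" d s'])
qed

lemma append_lns_assoc: "append_lns (append_lns G d S) e T = append_lns G d (append_lns S e T)"
  by (induction G) auto

text \<open>Moves the last component of a context to the other side, which gives the shape of the
  rules on two components.\<close>

lemma plug_plug: "plug (Some (plug G d (Last s))) e S = plug G d (Nest s e S)"
  by (cases G) (auto simp: append_lns_assoc)

text \<open>The equation for \<open>d\<close> keeps the convention for the first component, so that
  the translated premiss has exactly the list of the induction hypothesis.\<close>

lemma comps_eq_Cons:
  assumes "comps Fwd S = (d, \<Gamma>, \<Delta>) # L"
  obtains G \<Gamma>' \<Delta>' where "S = plug G d (Last (\<Gamma>' \<Rightarrow>\<^sub>s \<Delta>'))"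
    "\<Gamma> = set_mset \<Gamma>'" "\<Delta> = set_mset \<Delta>'" "L = ctx_comps G" "d = first_op G d"
proof -
  obtain G e s where S: "S = plug G e (Last s)" by (rule lns_cases_last)
  obtain \<Gamma>' \<Delta>' where s: "s = (\<Gamma>' \<Rightarrow>\<^sub>s \<Delta>')" by (cases s)
  from assms S s show thesis
    by (cases G) (auto intro: that[of G])
qed

lemma ctx_comps_eq_Cons:
  assumes "ctx_comps H = (d, \<Gamma>, \<Delta>) # L"
  obtains G \<Gamma>' \<Delta>' where "H = Some (plug G d (Last (\<Gamma>' \<Rightarrow>\<^sub>s \<Delta>')))"
    "\<Gamma> = set_mset \<Gamma>'" "\<Delta> = set_mset \<Delta>'" "L = ctx_comps G" "d = first_op G d"
  using assms by (cases H) (auto elim: comps_eq_Cons)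

text \<open>The induction ranges over every \<open>S\<close> with the given sets, whatever the
  multiplicities. A member can therefore be split off as the principal occurrence; a premiss that
  retains it still has the required sets.\<close>

lemma der_imp_derivable: "der L \<Longrightarrow> comps Fwd S = L \<Longrightarrow> derivable S"
proof (induction arbitrary: S rule: der.induct)
  case (id p \<Gamma> \<Delta> d L)
  from id.prems obtain G \<Gamma>1 \<Delta>1 where "S = plug G d (Last (\<Gamma>1 \<Rightarrow>\<^sub>s \<Delta>1))"
    "\<Gamma> = set_mset \<Gamma>1" "\<Delta> = set_mset \<Delta>1" by (rule comps_eq_Cons)
  with id.hyps show ?case
    using derivable.Id[of G d p "\<Gamma>1 - {#Atom p#}" "\<Delta>1 - {#Atom p#}"] by simp
next
  case (botL \<Gamma> d \<Delta> L)
  from botL.prems obtain G \<Gamma>1 \<Delta>1 where "S = plug G d (Last (\<Gamma>1 \<Rightarrow>\<^sub>s \<Delta>1))"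
    "\<Gamma> = set_mset \<Gamma>1" "\<Delta> = set_mset \<Delta>1" by (rule comps_eq_Cons)
  with botL.hyps show ?case
    using derivable.BotL[of G d "\<Gamma>1 - {#Bot#}" \<Delta>1] by simp
next
  case (ew L x)
  obtain d \<Gamma> \<Delta> where x: "x = (d, \<Gamma>, \<Delta>)" by (cases x)
  from ew.prems[unfolded x] obtain G \<Gamma>1 \<Delta>1 where S: "S = plug G d (Last (\<Gamma>1 \<Rightarrow>\<^sub>s \<Delta>1))"
    and L: "L = ctx_comps G" by (rule comps_eq_Cons)
  \<comment> \<open>No rule concludes the empty list, so the context is nonempty, as
    \<open>EW\<close> demands.\<close>
  from ew.hyps have "L \<noteq> []" by (auto elim: der.cases)
  with L obtain G' where "G = Some G'" by (cases G) auto
  with S L show ?case using derivable.EW[OF ew.IH] by simp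
next
  case (impR A B \<Delta> d \<Gamma> L)
  from impR.prems obtain G \<Gamma>1 \<Delta>1 where S: "S = plug G d (Last (\<Gamma>1 \<Rightarrow>\<^sub>s \<Delta>1))"
    and eq: "\<Gamma> = set_mset \<Gamma>1" "\<Delta> = set_mset \<Delta>1" "L = ctx_comps G" "d = first_op G d"
    by (rule comps_eq_Cons)
  obtain \<Delta>2 where \<Delta>2: "\<Delta>1 = add_mset (Imp A B) \<Delta>2"
    using impR.hyps eq by (auto dest: multi_member_split)
  show ?case unfolding S \<Delta>2
    by (rule derivable.ImpR, rule impR.IH) (use eq \<Delta>2 in \<open>simp add: insert_commute\<close>)
next
  case (impL A B \<Gamma> d \<Delta> L)
  from impL.prems obtain G \<Gamma>1 \<Delta>1 where S: "S = plug G d (Last (\<Gamma>1 \<Rightarrow>\<^sub>s \<Delta>1))"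
    and eq: "\<Gamma> = set_mset \<Gamma>1" "\<Delta> = set_mset \<Delta>1" "L = ctx_comps G" "d = first_op G d"
    by (rule comps_eq_Cons)
  obtain \<Gamma>2 where \<Gamma>2: "\<Gamma>1 = add_mset (Imp A B) \<Gamma>2"
    using impL.hyps eq by (auto dest: multi_member_split)
  show ?case unfolding S \<Gamma>2
    by (rule derivable.ImpL; rule impL.IH) (use eq \<Gamma>2 in \<open>simp_all add: insert_commute\<close>)
next
  case (bxR1 e A \<Delta> \<Gamma> d \<Gamma>' \<Delta>' L)
  from bxR1.prems obtain H \<Gamma>1 \<Delta>1 where S: "S = plug H e (Last (\<Gamma>1 \<Rightarrow>\<^sub>s \<Delta>1))"
    and eq: "\<Gamma> = set_mset \<Gamma>1" "\<Delta> = set_mset \<Delta>1" "(d, \<Gamma>', \<Delta>') # L = ctx_comps H"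
    by (rule comps_eq_Cons)
  from eq(3)[symmetric] obtain G \<Gamma>2 \<Delta>2 where H: "H = Some (plug G d (Last (\<Gamma>2 \<Rightarrow>\<^sub>s \<Delta>2)))"
    and eq': "\<Gamma>' = set_mset \<Gamma>2" "\<Delta>' = set_mset \<Delta>2" "L = ctx_comps G" "d = first_op G d"
    by (rule ctx_comps_eq_Cons)
  obtain \<Delta>3 where \<Delta>3: "\<Delta>1 = add_mset (bx (flip e) A) \<Delta>3"
    using bxR1.hyps eq by (auto dest: multi_member_split)
  have 1: "derivable (plug G d (Nest (\<Gamma>2 \<Rightarrow>\<^sub>s add_mset A \<Delta>2) e (Last (\<Gamma>1 \<Rightarrow>\<^sub>s \<Delta>1))))"
    by (rule bxR1.IH(1)) (use eq eq' in simp)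
  have 2: "derivable (plug G d (Nest (\<Gamma>2 \<Rightarrow>\<^sub>s \<Delta>2) e (Nest (\<Gamma>1 \<Rightarrow>\<^sub>s \<Delta>1) (flip e) (Last ({#} \<Rightarrow>\<^sub>s {#A#})))))"
    by (rule bxR1.IH(2)) (use eq eq' in simp)
  from 1 2 show ?case unfolding S H plug_plug \<Delta>3
    by (cases e) (auto intro: derivable.BoxR1 derivable.BBoxR1)
next
  case (bxR2 e A \<Delta> L d \<Gamma>)
  from bxR2.prems obtain G \<Gamma>1 \<Delta>1 where S: "S = plug G d (Last (\<Gamma>1 \<Rightarrow>\<^sub>s \<Delta>1))"
    and eq: "\<Gamma> = set_mset \<Gamma>1" "\<Delta> = set_mset \<Delta>1" "L = ctx_comps G" "d = first_op G d"
    by (rule comps_eq_Cons)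
  obtain \<Delta>2 where \<Delta>2: "\<Delta>1 = add_mset (bx e A) \<Delta>2"
    using bxR2.hyps eq by (auto dest: multi_member_split)
  have 1: "derivable (plug G d (Nest (\<Gamma>1 \<Rightarrow>\<^sub>s \<Delta>1) e (Last ({#} \<Rightarrow>\<^sub>s {#A#}))))"
    by (rule bxR2.IH) (use eq in simp)
  \<comment> \<open>Either \<open>plug\<close> drops the operator, or the side condition makes it
    agree with the box.\<close>
  have "G = None \<or> d = e"
  proof (cases G)
    case (Some K)
    then have "L \<noteq> []" using eq by (cases K) auto
    then show ?thesis using bxR2.hyps by simp
  qed simp
  then have "plug G d T = plug G e T" for T by auto
  with 1 show ?case unfolding S \<Delta>2
    by (cases e) (auto intro: derivable.BoxR2 derivable.BBoxR2)
next
  case (bxL1 e A \<Gamma>' \<Gamma> \<Delta> d \<Delta>' L)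
  from bxL1.prems obtain H \<Gamma>1 \<Delta>1 where S: "S = plug H e (Last (\<Gamma>1 \<Rightarrow>\<^sub>s \<Delta>1))"
    and eq: "\<Gamma> = set_mset \<Gamma>1" "\<Delta> = set_mset \<Delta>1" "(d, \<Gamma>', \<Delta>') # L = ctx_comps H"
    by (rule comps_eq_Cons)
  from eq(3)[symmetric] obtain G \<Gamma>2 \<Delta>2 where H: "H = Some (plug G d (Last (\<Gamma>2 \<Rightarrow>\<^sub>s \<Delta>2)))"
    and eq': "\<Gamma>' = set_mset \<Gamma>2" "\<Delta>' = set_mset \<Delta>2" "L = ctx_comps G" "d = first_op G d"
    by (rule ctx_comps_eq_Cons)
  obtain \<Gamma>3 where \<Gamma>3: "\<Gamma>2 = add_mset (bx e A) \<Gamma>3"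
    using bxL1.hyps eq' by (auto dest: multi_member_split)
  have "derivable (plug G d (Nest (\<Gamma>2 \<Rightarrow>\<^sub>s \<Delta>2) e (Last (add_mset A \<Gamma>1 \<Rightarrow>\<^sub>s \<Delta>1))))"
    by (rule bxL1.IH) (use eq eq' in simp)
  then show ?case unfolding S H plug_plug \<Gamma>3
    by (cases e) (auto intro: derivable.BoxL1 derivable.BBoxL1)
next
  case (bxL2 e A \<Gamma> d \<Gamma>' \<Delta>' L \<Delta>)
  from bxL2.prems obtain H \<Gamma>1 \<Delta>1 where S: "S = plug H e (Last (\<Gamma>1 \<Rightarrow>\<^sub>s \<Delta>1))"
    and eq: "\<Gamma> = set_mset \<Gamma>1" "\<Delta> = set_mset \<Delta>1" "(d, \<Gamma>', \<Delta>') # L = ctx_comps H"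
    by (rule comps_eq_Cons)
  from eq(3)[symmetric] obtain G \<Gamma>2 \<Delta>2 where H: "H = Some (plug G d (Last (\<Gamma>2 \<Rightarrow>\<^sub>s \<Delta>2)))"
    and eq': "\<Gamma>' = set_mset \<Gamma>2" "\<Delta>' = set_mset \<Delta>2" "L = ctx_comps G" "d = first_op G d"
    by (rule ctx_comps_eq_Cons)
  obtain \<Gamma>3 where \<Gamma>3: "\<Gamma>1 = add_mset (bx (flip e) A) \<Gamma>3"
    using bxL2.hyps eq by (auto dest: multi_member_split)
  have "derivable (plug G d (Last (add_mset A \<Gamma>2 \<Rightarrow>\<^sub>s \<Delta>2)))"
    by (rule bxL2.IH) (use eq eq' in simp)
  then show ?case unfolding S H plug_plug \<Gamma>3
    by (cases e) (auto intro: derivable.BoxL2 derivable.BBoxL2)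
qed

lemma derivable_iff_der: "derivable S \<longleftrightarrow> der (comps Fwd S)"
  using derivable_imp_der der_imp_derivable by blast

section \<open>Merging and the cut rule\<close>

text \<open>Merging only adds formulae to components; equal operators exclude the clashing clauses,
  where the merge is undefined.\<close>

lemma le_merge:
  "ops G = ops H \<Longrightarrow> le (comps d G) (comps d (G \<oplus> H)) \<and> le (comps d H) (comps d (G \<oplus> H))"
  by (induction G H arbitrary: d rule: merge_lns.induct) (auto intro!: list_all2_appendI)

lemma ops_append: "ops (append_lns G d S) = ops G @ d # ops S"
  by (induction G) auto

text \<open>Equivalence of the full sequents forces the contexts to be both empty or both nonempty
  with the same operators, so the unspecified cases of \<open>merge_ctx\<close> do not
  arise.\<close>

lemma ctx_merge:
  assumes "struct_equiv (plug G d (Last s)) (plug H d (Last t))"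
  shows "le (ctx_comps G) (ctx_comps (merge_ctx G H))" "le (ctx_comps H) (ctx_comps (merge_ctx G H))"
    "first_op (merge_ctx G H) d = first_op G d" "first_op H d = first_op G d"
  using assms by (cases G; cases H; simp add: struct_equiv_def ops_append le_merge)+

theorem theorem17:
  fixes G H :: "'p lns option" and d :: nesting
    and A :: "'p fm" and \<Gamma> \<Delta> \<Sigma> \<Pi> :: "'p fm multiset"
  assumes "derivable (plug G d (Last (\<Gamma> \<Rightarrow>\<^sub>s add_mset A \<Delta>)))"
    and "derivable (plug H d (Last (add_mset A \<Sigma> \<Rightarrow>\<^sub>s \<Pi>)))"
    and "struct_equiv (plug G d (Last (\<Gamma> \<Rightarrow>\<^sub>s \<Delta>))) (plug H d (Last (add_mset A \<Sigma> \<Rightarrow>\<^sub>s \<Pi>)))"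
  shows "derivable (plug (merge_ctx G H) d (Last (\<Gamma> + \<Sigma> \<Rightarrow>\<^sub>s \<Delta> + \<Pi>)))"
proof -
  note m = ctx_merge[OF assms(3)]
  let ?d = "first_op G d" and ?M = "ctx_comps (merge_ctx G H)"
  let ?\<Gamma> = "set_mset (\<Gamma> + \<Sigma>)" and ?\<Delta> = "set_mset (\<Delta> + \<Pi>)"
  \<comment> \<open>Both derivations are weakened to the merged context, which leaves a cut with
    shared context.\<close>
  have "der ((?d, ?\<Gamma>, insert A ?\<Delta>) # ?M)"
    using derivable_imp_der[OF assms(1)] by (rule weakening) (use m in auto)
  moreover have "der ((?d, insert A ?\<Gamma>, ?\<Delta>) # ?M)"
    using derivable_imp_der[OF assms(2)] by (rule weakening) (use m in auto)
  ultimately have "der ((?d, ?\<Gamma>, ?\<Delta>) # ?M)"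
    by (rule cut_admissible_last[OF cut_admissible])
  then show ?thesis by (simp add: derivable_iff_der m)
qed

end
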